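(* Let $\mathfrak{C}$ be a concrete category with forgetful functor $|\cdot|$, with a left adjoint $\mathbf{F}$ to $|\cdot|$, and with a distinguished class of nice epimorphisms. Let $\mathbb{M}$ be a countable monoid and let $\mathbf{F}\omega$ denote the free $\mathfrak{C}$-object over the set of natural numbers $\omega$. Then there exists an $\mathbb{M}$-action $\sigma$ on $\mathbf{F}\omega$ with the following property: for every countably generated $\mathfrak{C}$-object $A$ and every $\mathbb{M}$-action $\phi$ on $A$, there exists a nice epimorphism $p\colon \mathbf{F}\omega \to A$ commuting with the $\mathbb{M}$-actions, that is, $p\circ \sigma(m) = \phi(m)\circ p$ for every $m\in\mathbb{M}$.
   Context: Let $\mathfrak{Ens}$ be the category of nonempty sets with arbitrary mappings. A concrete category is a category $\mathfrak{C}$ with a faithful (forgetful) functor $|\cdot|\colon \mathfrak{C}\to\mathfrak{Ens}$. A left adjoint $\mathbf{F}\colon \mathfrak{Ens}\to\mathfrak{C}$ to $|\cdot|$ comes with a natural transformation $\eta_X\colon X\to|\mathbf{F}X|$ such that for every nonempty set $X$, every $\mathfrak{C}$-object $A$ and every mapping $f\colon X\to |A|$ there is a unique $\mathfrak{C}$-arrow $\widehat{f}\colon \mathbf{F}X\to A$ with $|\widehat{f}|\circ\eta_X=f$. The object $\mathbf{F}X$ (with $\eta_X$) is called the free $\mathfrak{C}$-object over $X$. The nice epimorphisms are the arrows of a distinguished subcategory $\mathfrak{C}^{\heartsuit}$ of $\mathfrak{C}$ satisfying: (N0) all $\mathfrak{C}^{\heartsuit}$-arrows are epimorphisms of $\mathfrak{C}$;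 (N1) every right-invertible $\mathfrak{C}$-arrow is in $\mathfrak{C}^{\heartsuit}$; (N2) if $g\circ h\in\mathfrak{C}^{\heartsuit}$ then $g\in\mathfrak{C}^{\heartsuit}$. A $\mathfrak{C}$-object $A$ is generated by a (nonempty) set $X\subseteq|A|$ if, for the inclusion $\iota\colon X\to|A|$, the arrow $\widehat{\iota}\colon\mathbf{F}X\to A$ is a nice epimorphism. $A$ is countably generated if it is generated by some countable (finite or infinite) set. An $\mathbb{M}$-action on an object $A$ is a monoid homomorphism $\phi\colon\mathbb{M}\to\operatorname{End}(A)$ into the endomorphism monoid of $A$. *)

theory Defs
  imports "HOL-Algebra.Group" "HOL-Library.Countable_Set" "HOL-Library.FuncSet"
begin

section \<open>Categories and functors\<close>

record ('o, 'a) category_data =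
  Obj   :: "'o set"
  Arr   :: "'a set"
  Dom   :: "'a \<Rightarrow> 'o"
  Cod   :: "'a \<Rightarrow> 'o"
  Ident :: "'o \<Rightarrow> 'a"
  Comp  :: "'a \<Rightarrow> 'a \<Rightarrow> 'a"  (infixl "\<cdot>\<index>" 70)

text \<open>\<open>g \<cdot>\<^bsub>C\<^esub> f\<close> is ``\<open>g\<close> after \<open>f\<close>''; it is meaningful only if \<open>Cod C f = Dom C g\<close>.\<close>

definition arrows :: "('o, 'a) category_data \<Rightarrow> 'o \<Rightarrow> 'o \<Rightarrow> 'a set" where
  "arrows C A B = {f \<in> Arr C. Dom C f = A \<and> Cod C f = B}"

locale category =
  fixes C :: "('o, 'a) category_data"
  assumes Dom_in_Obj: "f \<in> Arr C \<Longrightarrow> Dom C f \<in> Obj C"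
    and Cod_in_Obj: "f \<in> Arr C \<Longrightarrow> Cod C f \<in> Obj C"
    and Ident_in_arrows: "A \<in> Obj C \<Longrightarrow> Ident C A \<in> arrows C A A"
    and Comp_in_arrows:
      "\<lbrakk>f \<in> Arr C; g \<in> Arr C; Cod C f = Dom C g\<rbrakk> \<Longrightarrow> g \<cdot>\<^bsub>C\<^esub> f \<in> arrows C (Dom C f) (Cod C g)"
    and Comp_Ident_right: "f \<in> Arr C \<Longrightarrow> f \<cdot>\<^bsub>C\<^esub> Ident C (Dom C f) = f"
    and Comp_Ident_left: "f \<in> Arr C \<Longrightarrow> Ident C (Cod C f) \<cdot>\<^bsub>C\<^esub> f = f"
    and Comp_assoc:
      "\<lbrakk>f \<in> Arr C; g \<in> Arr C; h \<in> Arr C; Cod C f = Dom C g; Cod C g = Dom C h\<rbrakk>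
        \<Longrightarrow> (h \<cdot>\<^bsub>C\<^esub> g) \<cdot>\<^bsub>C\<^esub> f = h \<cdot>\<^bsub>C\<^esub> (g \<cdot>\<^bsub>C\<^esub> f)"

record ('o, 'a, 'p, 'b) functor_data =
  on_Obj :: "'o \<Rightarrow> 'p"
  on_Arr :: "'a \<Rightarrow> 'b"

locale is_functor =
  source: category C + target: category D
  for C :: "('o, 'a) category_data" and D :: "('p, 'b) category_data" +
  fixes F :: "('o, 'a, 'p, 'b) functor_data"
  assumes on_Obj_in_Obj: "A \<in> Obj C \<Longrightarrow> on_Obj F A \<in> Obj D"
    and on_Arr_in_arrows:
      "f \<in> Arr C \<Longrightarrow> on_Arr F f \<in> arrows D (on_Obj F (Dom C f)) (on_Obj F (Cod C f))"
    and on_Arr_Ident: "A \<in> Obj C \<Longrightarrow> on_Arr F (Ident C A) = Ident D (on_Obj F A)"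
    and on_Arr_Comp:
      "\<lbrakk>f \<in> Arr C; g \<in> Arr C; Cod C f = Dom C g\<rbrakk>
        \<Longrightarrow> on_Arr F (g \<cdot>\<^bsub>C\<^esub> f) = on_Arr F g \<cdot>\<^bsub>D\<^esub> on_Arr F f"

locale faithful_functor = is_functor +
  assumes faithful:
    "\<lbrakk>A \<in> Obj C; B \<in> Obj C\<rbrakk> \<Longrightarrow> inj_on (on_Arr F) (arrows C A B)"

definition epimorphism :: "('o, 'a) category_data \<Rightarrow> 'a \<Rightarrow> bool" where
  "epimorphism C e \<longleftrightarrow> e \<in> Arr C \<and>
    (\<forall>g \<in> Arr C. \<forall>h \<in> Arr C. Dom C g = Cod C e \<and> Dom C h = Cod C e \<and> Cod C g = Cod C h \<and>
      g \<cdot>\<^bsub>C\<^esub> e = h \<cdot>\<^bsub>C\<^esub> e \<longrightarrow> g = h)"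

definition right_invertible :: "('o, 'a) category_data \<Rightarrow> 'a \<Rightarrow> bool" where
  "right_invertible C g \<longleftrightarrow> g \<in> Arr C \<and>
    (\<exists>h \<in> arrows C (Cod C g) (Dom C g). g \<cdot>\<^bsub>C\<^esub> h = Ident C (Cod C g))"

text \<open>A subcategory is represented by its set of arrows; its objects are those whose
  identity belongs to this set.\<close>

definition subcategory :: "('o, 'a) category_data \<Rightarrow> 'a set \<Rightarrow> bool" where
  "subcategory C N \<longleftrightarrow> N \<subseteq> Arr C \<and>
    (\<forall>f \<in> N. Ident C (Dom C f) \<in> N \<and> Ident C (Cod C f) \<in> N) \<and>
    (\<forall>f \<in> N. \<forall>g \<in> N. Cod C f = Dom C g \<longrightarrow> g \<cdot>\<^bsub>C\<^esub> f \<in> N)"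


section \<open>The category of nonempty sets\<close>

text \<open>There is no type of all sets. The sets under consideration are the members of a family
  \<open>U\<close> of subsets of an arbitrary type; think of the small sets of a set-theoretic universe.
  Taking all subsets of the type would be too restrictive: a free functor need not be able to
  handle sets as large as the universe itself. We require that \<open>U\<close> is closed under
  subsets, and that it contains a copy \<open>range \<omega>\<close> of the set of natural numbers.\<close>

locale set_universe =
  fixes U :: "'u set set" and \<omega> :: "nat \<Rightarrow> 'u"
  assumes subset_in_U: "\<lbrakk>Y \<in> U; X \<subseteq> Y\<rbrakk> \<Longrightarrow> X \<in> U"
    and inj_omega: "inj \<omega>"
    and omega_in_U: "range \<omega> \<in> U"

datatype 'u setmap = Setmap (src: "'u set") (tgt: "'u set") (fn: "'u \<Rightarrow> 'u")

text \<open>The underlying functions are extensional (undefined outside the source), so that equality of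
  arrows is equality of mappings.\<close>

definition Ens :: "'u set set \<Rightarrow> ('u set, 'u setmap) category_data" where
  "Ens U = \<lparr>
     Obj = {X \<in> U. X \<noteq> {}},
     Arr = {f. src f \<in> U \<and> src f \<noteq> {} \<and> tgt f \<in> U \<and> tgt f \<noteq> {} \<and> fn f \<in> src f \<rightarrow>\<^sub>E tgt f},
     Dom = src,
     Cod = tgt,
     Ident = (\<lambda>X. Setmap X X (\<lambda>x\<in>X. x)),
     Comp = (\<lambda>g f. Setmap (src f) (tgt g) (compose (src f) (fn g) (fn f)))\<rparr>"

lemma category_Ens: "category (Ens U)"
proof
  fix f g h assume "f \<in> Arr (Ens U)" "g \<in> Arr (Ens U)" "h \<in> Arr (Ens U)"
    "Cod (Ens U) f = Dom (Ens U) g" "Cod (Ens U) g = Dom (Ens U) h"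
  then show "(h \<cdot>\<^bsub>Ens U\<^esub> g) \<cdot>\<^bsub>Ens U\<^esub> f = h \<cdot>\<^bsub>Ens U\<^esub> (g \<cdot>\<^bsub>Ens U\<^esub> f)"
    by (auto simp: Ens_def compose_def fun_eq_iff PiE_iff)
next
  fix f assume "f \<in> Arr (Ens U)"
  then show "f \<cdot>\<^bsub>Ens U\<^esub> Ident (Ens U) (Dom (Ens U) f) = f"
    by (cases f) (auto simp: Ens_def compose_def fun_eq_iff PiE_iff extensional_def)
next
  fix f assume "f \<in> Arr (Ens U)"
  then show "Ident (Ens U) (Cod (Ens U) f) \<cdot>\<^bsub>Ens U\<^esub> f = f"
    by (cases f) (auto simp: Ens_def compose_def fun_eq_iff PiE_iff extensional_def)
qed (auto simp: Ens_def arrows_def compose_def)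

definition inclusion :: "'u set \<Rightarrow> 'u set \<Rightarrow> 'u setmap" where
  "inclusion X Y = Setmap X Y (\<lambda>x\<in>X. x)"


section \<open>Concrete categories with free objects and nice epimorphisms\<close>

locale concrete_category =
  set_universe U \<omega> + faithful_functor C "Ens U" V
  for U :: "'u set set" and \<omega> :: "nat \<Rightarrow> 'u"
    and C :: "('o, 'a) category_data"
    and V :: "('o, 'a, 'u set, 'u setmap) functor_data"

text \<open>\<open>V\<close> is the forgetful functor, \<open>F\<close> its left adjoint, \<open>\<eta>\<close> the unit of the adjunction.\<close>

locale free_concrete_category =
  concrete_category U \<omega> C V + free: is_functor "Ens U" C F
  for U :: "'u set set" and \<omega> :: "nat \<Rightarrow> 'u"
    and C :: "('o, 'a) category_data"
    and V :: "('o, 'a, 'u set, 'u setmap) functor_data"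
    and F :: "('u set, 'u setmap, 'o, 'a) functor_data" +
  fixes \<eta> :: "'u set \<Rightarrow> 'u setmap"
  assumes unit_in_arrows:
      "X \<in> Obj (Ens U) \<Longrightarrow> \<eta> X \<in> arrows (Ens U) X (on_Obj V (on_Obj F X))"
    and unit_natural:
      "f \<in> arrows (Ens U) X Y
        \<Longrightarrow> on_Arr V (on_Arr F f) \<cdot>\<^bsub>Ens U\<^esub> \<eta> X = \<eta> Y \<cdot>\<^bsub>Ens U\<^esub> f"
    and universal:
      "\<lbrakk>X \<in> Obj (Ens U); A \<in> Obj C; f \<in> arrows (Ens U) X (on_Obj V A)\<rbrakk>
        \<Longrightarrow> \<exists>!g. g \<in> arrows C (on_Obj F X) A \<and> on_Arr V g \<cdot>\<^bsub>Ens U\<^esub> \<eta> X = f"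
begin

text \<open>The arrow \<open>F X \<rightarrow> A\<close> induced by \<open>f : X \<rightarrow> |A|\<close>. The object \<open>A\<close> has to be given
  explicitly, as it is not determined by its underlying set.\<close>

definition hat :: "'o \<Rightarrow> 'u setmap \<Rightarrow> 'a" where
  "hat A f = (THE g. g \<in> arrows C (on_Obj F (src f)) A \<and> on_Arr V g \<cdot>\<^bsub>Ens U\<^esub> \<eta> (src f) = f)"

end

locale nice_concrete_category =
  free_concrete_category U \<omega> C V F \<eta>
  for U :: "'u set set" and \<omega> :: "nat \<Rightarrow> 'u"
    and C :: "('o, 'a) category_data"
    and V :: "('o, 'a, 'u set, 'u setmap) functor_data"
    and F :: "('u set, 'u setmap, 'o, 'a) functor_data"
    and \<eta> :: "'u set \<Rightarrow> 'u setmap" +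
  fixes N :: "'a set"
  assumes nice_subcategory: "subcategory C N"
    and N0: "e \<in> N \<Longrightarrow> epimorphism C e"
    and N1: "right_invertible C g \<Longrightarrow> g \<in> N"
    and N2: "\<lbrakk>g \<in> Arr C; h \<in> Arr C; Cod C h = Dom C g; g \<cdot>\<^bsub>C\<^esub> h \<in> N\<rbrakk> \<Longrightarrow> g \<in> N"
begin

definition generated_by :: "'o \<Rightarrow> 'u set \<Rightarrow> bool" where
  "generated_by A X \<longleftrightarrow> X \<noteq> {} \<and> X \<subseteq> on_Obj V A \<and> hat A (inclusion X (on_Obj V A)) \<in> N"

definition countably_generated :: "'o \<Rightarrow> bool" where
  "countably_generated A \<longleftrightarrow> (\<exists>X. countable X \<and> generated_by A X)"

end


section \<open>Monoid actions\<close>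

definition End :: "('o, 'a) category_data \<Rightarrow> 'o \<Rightarrow> 'a monoid" where
  "End C A = \<lparr>carrier = arrows C A A, mult = Comp C, one = Ident C A\<rparr>"

lemma (in category) monoid_End:
  assumes "A \<in> Obj C"
  shows "monoid (End C A)"
proof
  fix x y z assume "x \<in> carrier (End C A)" "y \<in> carrier (End C A)" "z \<in> carrier (End C A)"
  then show "x \<otimes>\<^bsub>End C A\<^esub> y \<otimes>\<^bsub>End C A\<^esub> z = x \<otimes>\<^bsub>End C A\<^esub> (y \<otimes>\<^bsub>End C A\<^esub> z)"
    by (simp add: End_def arrows_def Comp_assoc)
next
  fix x assume "x \<in> carrier (End C A)"
  then show "\<one>\<^bsub>End C A\<^esub> \<otimes>\<^bsub>End C A\<^esub> x = x" "x \<otimes>\<^bsub>End C A\<^esub> \<one>\<^bsub>End C A\<^esub> = x"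
    using Comp_Ident_left[of x] Comp_Ident_right[of x] by (simp_all add: End_def arrows_def)
qed (use assms Ident_in_arrows Comp_in_arrows in \<open>auto simp: End_def arrows_def\<close>)

text \<open>The library's \<open>hom\<close> does not require the unit to be preserved.\<close>

definition monoid_action ::
  "('m, 'b) monoid_scheme \<Rightarrow> ('o, 'a) category_data \<Rightarrow> 'o \<Rightarrow> ('m \<Rightarrow> 'a) \<Rightarrow> bool" where
  "monoid_action M C A \<phi> \<longleftrightarrow> \<phi> \<in> hom M (End C A) \<and> \<phi> \<one>\<^bsub>M\<^esub> = \<one>\<^bsub>End C A\<^esub>"

end

theory Submission
  imports Defs
begin

text \<open>
  An action of \<open>M\<close> on \<open>F \<omega>\<close> is obtained by applying \<open>F\<close> to an action of \<open>M\<close> on the set \<open>\<omega>\<close>.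
  Since \<open>M\<close> is countable and nonempty, \<open>\<omega>\<close> can be identified with \<open>M \<times> \<nat>\<close>, on which \<open>M\<close>
  acts by left multiplication in the first factor. This is the free \<open>M\<close>-set on countably many
  generators \<open>(1, n)\<close>, and the universal action \<open>\<sigma>\<close> is its image under \<open>F\<close>.

  Given an action \<open>\<phi>\<close> on an object \<open>A\<close> generated by a countable set \<open>X\<close>, enumerate \<open>X\<close> as
  \<open>s 0, s 1, \<dots>\<close> (with repetitions) and extend \<open>(1, n) \<mapsto> s n\<close> equivariantly to
  \<open>f (m, n) = |\<phi> m| (s n)\<close>. The arrow \<open>p : F \<omega> \<rightarrow> A\<close> induced by \<open>f\<close> commutes with the actions
  because \<open>f\<close> does: two arrows out of a free object agree once they agree on the basis
  (\<open>hat_natural\<close>, \<open>comp_hat\<close>). It is nice because the inclusion of \<open>X\<close> into \<open>|A|\<close> factors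
  through \<open>f\<close>, because \<open>f (1, n) = s n\<close>; so the nice arrow \<open>F X \<rightarrow> A\<close> factors through \<open>p\<close>, and the
  left factor of a nice epimorphism is nice (\<open>hat_nice\<close>).
\<close>

section \<open>Mappings between nonempty sets\<close>

definition mapping :: "'u set \<Rightarrow> 'u set \<Rightarrow> ('u \<Rightarrow> 'u) \<Rightarrow> 'u setmap" where
  "mapping X Y f = Setmap X Y (restrict f X)"

lemma mapping_in_arrows:
  assumes "X \<in> U" "X \<noteq> {}" "Y \<in> U" "f ` X \<subseteq> Y"
  shows "mapping X Y f \<in> arrows (Ens U) X Y"
  using assms by (auto simp: mapping_def arrows_def Ens_def)

lemma mapping_cong:
  "(\<And>x. x \<in> X \<Longrightarrow> f x = g x) \<Longrightarrow> mapping X Y f = mapping X Y g"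
  by (auto simp: mapping_def fun_eq_iff)

lemma Comp_mapping:
  "f ` X \<subseteq> Y \<Longrightarrow> mapping Y Z g \<cdot>\<^bsub>Ens U\<^esub> mapping X Y f = mapping X Z (\<lambda>x. g (f x))"
  by (auto simp: mapping_def Ens_def compose_def fun_eq_iff)

lemma Ident_eq_mapping: "Ident (Ens U) X = mapping X X (\<lambda>x. x)"
  by (simp add: Ens_def mapping_def)

lemma inclusion_eq_mapping: "inclusion X Y = mapping X Y (\<lambda>x. x)"
  by (simp add: inclusion_def mapping_def)

lemma arrow_eq_mapping:
  assumes "u \<in> arrows (Ens U) X Y"
  shows "u = mapping X Y (fn u)"
  using assms by (cases u) (auto simp: mapping_def arrows_def Ens_def PiE_restrict)

lemma fn_arrow_in:
  assumes "u \<in> arrows (Ens U) X Y" "x \<in> X"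
  shows "fn u x \<in> Y"
  using assms by (auto simp: arrows_def Ens_def)

lemma fn_Comp:
  assumes "u \<in> arrows (Ens U) X Y" "x \<in> X"
  shows "fn (v \<cdot>\<^bsub>Ens U\<^esub> u) x = fn v (fn u x)"
  using assms by (auto simp: arrows_def Ens_def compose_def)

lemma (in category) Comp_arrows:
  assumes "g \<in> arrows C Y Z" "f \<in> arrows C X Y"
  shows "g \<cdot>\<^bsub>C\<^esub> f \<in> arrows C X Z"
  using assms Comp_in_arrows[of f g] by (auto simp: arrows_def)

lemma (in is_functor) on_arrows:
  assumes "f \<in> arrows C X Y"
  shows "on_Arr F f \<in> arrows D (on_Obj F X) (on_Obj F Y)"
  using assms on_Arr_in_arrows[of f] by (auto simp: arrows_def)


section \<open>Arrows out of free objects\<close>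

context free_concrete_category
begin

lemma hat_props:
  assumes "A \<in> Obj C" "f \<in> arrows (Ens U) X (on_Obj V A)"
  shows "hat A f \<in> arrows C (on_Obj F X) A"
    and "on_Arr V (hat A f) \<cdot>\<^bsub>Ens U\<^esub> \<eta> X = f"
proof -
  have X: "src f = X" "X \<in> Obj (Ens U)"
    using assms by (auto simp: arrows_def Ens_def)
  from theI'[OF universal[OF X(2) assms]]
  show "hat A f \<in> arrows C (on_Obj F X) A"
    and "on_Arr V (hat A f) \<cdot>\<^bsub>Ens U\<^esub> \<eta> X = f"
    by (simp_all add: hat_def X)
qed

lemma hat_unique:
  assumes "A \<in> Obj C" "f \<in> arrows (Ens U) X (on_Obj V A)"
    and "g \<in> arrows C (on_Obj F X) A" "on_Arr V g \<cdot>\<^bsub>Ens U\<^esub> \<eta> X = f"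
  shows "hat A f = g"
proof -
  have "X \<in> Obj (Ens U)"
    using assms(2) by (auto simp: arrows_def Ens_def)
  from universal[OF this assms(1,2)] show ?thesis
    using assms hat_props[OF assms(1,2)] by blast
qed

text \<open>Both sides restrict to \<open>f \<circ> j\<close> along the unit: on the left, \<open>F j\<close> is moved past the
  unit by naturality.\<close>

lemma hat_natural:
  assumes A: "A \<in> Obj C" and f: "f \<in> arrows (Ens U) Y (on_Obj V A)"
    and j: "j \<in> arrows (Ens U) X Y"
  shows "hat A f \<cdot>\<^bsub>C\<^esub> on_Arr F j = hat A (f \<cdot>\<^bsub>Ens U\<^esub> j)"
proof (rule hat_unique[symmetric, OF A])
  have X: "X \<in> Obj (Ens U)" and Y: "Y \<in> Obj (Ens U)"
    using j by (auto simp: arrows_def Ens_def)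
  note h = hat_props[OF A f] and Fj = free.on_arrows[OF j]
  show "f \<cdot>\<^bsub>Ens U\<^esub> j \<in> arrows (Ens U) X (on_Obj V A)"
    by (rule target.Comp_arrows[OF f j])
  show "hat A f \<cdot>\<^bsub>C\<^esub> on_Arr F j \<in> arrows C (on_Obj F X) A"
    by (rule source.Comp_arrows[OF h(1) Fj])
  have "on_Arr V (hat A f \<cdot>\<^bsub>C\<^esub> on_Arr F j) \<cdot>\<^bsub>Ens U\<^esub> \<eta> X
      = (on_Arr V (hat A f) \<cdot>\<^bsub>Ens U\<^esub> on_Arr V (on_Arr F j)) \<cdot>\<^bsub>Ens U\<^esub> \<eta> X"
    using on_Arr_Comp[of "on_Arr F j" "hat A f"] h(1) Fj by (auto simp: arrows_def)
  also have "\<dots> = on_Arr V (hat A f) \<cdot>\<^bsub>Ens U\<^esub> (on_Arr V (on_Arr F j) \<cdot>\<^bsub>Ens U\<^esub> \<eta> X)"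
    using on_arrows[OF h(1)] on_arrows[OF Fj] unit_in_arrows[OF X]
    by (intro target.Comp_assoc) (auto simp: arrows_def)
  also have "\<dots> = on_Arr V (hat A f) \<cdot>\<^bsub>Ens U\<^esub> (\<eta> Y \<cdot>\<^bsub>Ens U\<^esub> j)"
    by (simp add: unit_natural[OF j])
  also have "\<dots> = (on_Arr V (hat A f) \<cdot>\<^bsub>Ens U\<^esub> \<eta> Y) \<cdot>\<^bsub>Ens U\<^esub> j"
    using on_arrows[OF h(1)] unit_in_arrows[OF Y] j
    by (intro target.Comp_assoc[symmetric]) (auto simp: arrows_def)
  finally show "on_Arr V (hat A f \<cdot>\<^bsub>C\<^esub> on_Arr F j) \<cdot>\<^bsub>Ens U\<^esub> \<eta> X = f \<cdot>\<^bsub>Ens U\<^esub> j"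
    by (simp add: h(2))
qed

lemma comp_hat:
  assumes A: "A \<in> Obj C" and B: "B \<in> Obj C" and u: "u \<in> arrows C A B"
    and f: "f \<in> arrows (Ens U) X (on_Obj V A)"
  shows "u \<cdot>\<^bsub>C\<^esub> hat A f = hat B (on_Arr V u \<cdot>\<^bsub>Ens U\<^esub> f)"
proof (rule hat_unique[symmetric, OF B])
  have X: "X \<in> Obj (Ens U)"
    using f by (auto simp: arrows_def Ens_def)
  note h = hat_props[OF A f]
  show "on_Arr V u \<cdot>\<^bsub>Ens U\<^esub> f \<in> arrows (Ens U) X (on_Obj V B)"
    by (rule target.Comp_arrows[OF on_arrows[OF u] f])
  show "u \<cdot>\<^bsub>C\<^esub> hat A f \<in> arrows C (on_Obj F X) B"
    by (rule source.Comp_arrows[OF u h(1)])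
  have "on_Arr V (u \<cdot>\<^bsub>C\<^esub> hat A f) \<cdot>\<^bsub>Ens U\<^esub> \<eta> X
      = (on_Arr V u \<cdot>\<^bsub>Ens U\<^esub> on_Arr V (hat A f)) \<cdot>\<^bsub>Ens U\<^esub> \<eta> X"
    using on_Arr_Comp[of "hat A f" u] h(1) u by (auto simp: arrows_def)
  also have "\<dots> = on_Arr V u \<cdot>\<^bsub>Ens U\<^esub> (on_Arr V (hat A f) \<cdot>\<^bsub>Ens U\<^esub> \<eta> X)"
    using on_arrows[OF h(1)] on_arrows[OF u] unit_in_arrows[OF X]
    by (intro target.Comp_assoc) (auto simp: arrows_def)
  finally show "on_Arr V (u \<cdot>\<^bsub>C\<^esub> hat A f) \<cdot>\<^bsub>Ens U\<^esub> \<eta> X = on_Arr V u \<cdot>\<^bsub>Ens U\<^esub> f"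
    by (simp add: h(2))
qed

end

context nice_concrete_category
begin

text \<open>If \<open>f : Y \<rightarrow> |A|\<close> covers a generating set \<open>X\<close>, then a section \<open>j : X \<rightarrow> Y\<close> of \<open>f\<close> over \<open>X\<close>
  exhibits the nice arrow \<open>F X \<rightarrow> A\<close> as the composite of \<open>F j\<close> and the arrow induced by \<open>f\<close>,
  so (N2) applies to the latter.\<close>

lemma hat_nice:
  assumes A: "A \<in> Obj C" and gen: "generated_by A X"
    and f: "f \<in> arrows (Ens U) Y (on_Obj V A)" and X: "X \<subseteq> fn f ` Y"
  shows "hat A f \<in> N"
proof -
  define j where "j = mapping X Y (inv_into Y (fn f))"
  have X_gen: "X \<noteq> {}" "X \<subseteq> on_Obj V A" "hat A (inclusion X (on_Obj V A)) \<in> N"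
    using gen by (auto simp: generated_by_def)
  have "on_Obj V A \<in> U" "Y \<in> U"
    using f by (auto simp: arrows_def Ens_def)
  then have "X \<in> U"
    using subset_in_U X_gen by blast
  have sec: "inv_into Y (fn f) ` X \<subseteq> Y"
    using X by (auto intro: inv_into_into)
  have j: "j \<in> arrows (Ens U) X Y"
    unfolding j_def by (rule mapping_in_arrows) (use \<open>X \<in> U\<close> \<open>Y \<in> U\<close> X_gen sec in auto)
  have "f \<cdot>\<^bsub>Ens U\<^esub> j = mapping Y (on_Obj V A) (fn f) \<cdot>\<^bsub>Ens U\<^esub> j"
    using arrow_eq_mapping[OF f] by simp
  also have "\<dots> = inclusion X (on_Obj V A)"
    unfolding j_def Comp_mapping[OF sec] inclusion_eq_mapping
    by (rule mapping_cong) (use X in \<open>auto intro: f_inv_into_f\<close>)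
  finally have "hat A f \<cdot>\<^bsub>C\<^esub> on_Arr F j \<in> N"
    using X_gen hat_natural[OF A f j] by simp
  with N2[of "hat A f" "on_Arr F j"] show ?thesis
    using hat_props(1)[OF A f] free.on_arrows[OF j] by (auto simp: arrows_def)
qed

end


section \<open>Actions on free objects\<close>

lemma (in free_concrete_category) monoid_action_free:
  fixes M :: "('m, 'b) monoid_scheme"
  assumes W: "W \<in> Obj (Ens U)"
    and closed: "\<And>m w. \<lbrakk>m \<in> carrier M; w \<in> W\<rbrakk> \<Longrightarrow> act m w \<in> W"
    and one: "\<one>\<^bsub>M\<^esub> \<in> carrier M" "\<And>w. w \<in> W \<Longrightarrow> act \<one>\<^bsub>M\<^esub> w = w"
    and mult: "\<And>m m' w. \<lbrakk>m \<in> carrier M; m' \<in> carrier M; w \<in> W\<rbrakk>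
      \<Longrightarrow> act (m \<otimes>\<^bsub>M\<^esub> m') w = act m (act m' w)"
  shows "monoid_action M C (on_Obj F W) (\<lambda>m. on_Arr F (mapping W W (act m)))"
proof -
  have arr: "mapping W W (act m) \<in> arrows (Ens U) W W" if "m \<in> carrier M" for m
    using W closed[OF that] by (intro mapping_in_arrows) (auto simp: Ens_def)
  have "mapping W W (act (m \<otimes>\<^bsub>M\<^esub> m')) = mapping W W (act m) \<cdot>\<^bsub>Ens U\<^esub> mapping W W (act m')"
    if "m \<in> carrier M" "m' \<in> carrier M" for m m'
    using closed[OF that(2)] mult[OF that]
    by (subst Comp_mapping) (auto intro: mapping_cong)
  moreover have "mapping W W (act \<one>\<^bsub>M\<^esub>) = Ident (Ens U) W"
    unfolding Ident_eq_mapping by (rule mapping_cong) (rule one)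
  ultimately show ?thesis
    using arr free.on_arrows[OF arr] free.on_Arr_Ident[OF W] free.on_Arr_Comp
    by (auto simp: monoid_action_def hom_def End_def arrows_def)
qed

lemma (in concrete_category) fn_action_mult:
  assumes "monoid_action M C A \<phi>" "m \<in> carrier M" "m' \<in> carrier M" "a \<in> on_Obj V A"
  shows "fn (on_Arr V (\<phi> (m \<otimes>\<^bsub>M\<^esub> m'))) a = fn (on_Arr V (\<phi> m)) (fn (on_Arr V (\<phi> m')) a)"
proof -
  have m: "\<phi> m \<in> arrows C A A" and m': "\<phi> m' \<in> arrows C A A"
    and "\<phi> (m \<otimes>\<^bsub>M\<^esub> m') = \<phi> m \<cdot>\<^bsub>C\<^esub> \<phi> m'"
    using assms by (auto simp: monoid_action_def hom_def End_def)
  then have "on_Arr V (\<phi> (m \<otimes>\<^bsub>M\<^esub> m')) = on_Arr V (\<phi> m) \<cdot>\<^bsub>Ens U\<^esub> on_Arr V (\<phi> m')"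
    using on_Arr_Comp by (auto simp: arrows_def)
  then show ?thesis
    by (simp add: fn_Comp[OF on_arrows[OF m'] assms(4)])
qed

lemma (in concrete_category) fn_action_one:
  assumes "A \<in> Obj C" "monoid_action M C A \<phi>" "a \<in> on_Obj V A"
  shows "fn (on_Arr V (\<phi> \<one>\<^bsub>M\<^esub>)) a = a"
  using assms by (simp add: monoid_action_def End_def on_Arr_Ident Ident_eq_mapping mapping_def)

section \<open>The universal action\<close>

theorem theorem2p1:
  fixes U :: "'u set set" and \<omega> :: "nat \<Rightarrow> 'u"
    and C :: "('o, 'a) category_data"
    and V :: "('o, 'a, 'u set, 'u setmap) functor_data"
    and F :: "('u set, 'u setmap, 'o, 'a) functor_data"
    and \<eta> :: "'u set \<Rightarrow> 'u setmap"
    and N :: "'a set"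
    and M :: "('m, 'b) monoid_scheme"
  assumes "nice_concrete_category U \<omega> C V F \<eta> N"
    and "monoid M" and "countable (carrier M)"
  shows "\<exists>\<sigma>. monoid_action M C (on_Obj F (range \<omega>)) \<sigma> \<and>
    (\<forall>A \<phi>. A \<in> Obj C \<longrightarrow> nice_concrete_category.countably_generated U C V F \<eta> N A \<longrightarrow>
      monoid_action M C A \<phi> \<longrightarrow>
      (\<exists>p \<in> arrows C (on_Obj F (range \<omega>)) A. p \<in> N \<and>
        (\<forall>m \<in> carrier M. p \<cdot>\<^bsub>C\<^esub> \<sigma> m = \<phi> m \<cdot>\<^bsub>C\<^esub> p)))"
proof -
  interpret nice_concrete_category U \<omega> C V F \<eta> N by fact
  interpret M: monoid M by fact
  let ?W = "range \<omega>"
  have W: "?W \<in> Obj (Ens U)"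
    using omega_in_U by (auto simp: Ens_def)
  have "infinite (carrier M \<times> (UNIV :: nat set))"
    using M.one_closed by (auto simp: finite_cartesian_product_iff)
  then obtain e where e: "bij_betw e (carrier M \<times> (UNIV :: nat set)) (UNIV :: nat set)"
    using assms(3) by (auto elim: countableE_infinite[rotated])
  define enc where "enc = \<omega> \<circ> e"
  have enc: "bij_betw enc (carrier M \<times> UNIV) ?W"
    unfolding enc_def by (rule bij_betw_trans[OF e]) (simp add: bij_betw_def inj_omega)
  define dec where "dec = inv_into (carrier M \<times> UNIV) enc"
  have dec_enc: "dec (enc (m, n)) = (m, n)" if "m \<in> carrier M" for m n
    using enc that by (simp add: dec_def bij_betw_def)
  have enc_in: "enc (m, n) \<in> ?W" if "m \<in> carrier M" for m n
    using enc that by (auto simp: bij_betw_def)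
  have W_cases: "\<exists>m n. m \<in> carrier M \<and> w = enc (m, n)" if "w \<in> ?W" for w
  proof -
    have "w \<in> enc ` (carrier M \<times> UNIV)"
      using enc that by (simp add: bij_betw_imp_surj_on)
    then show ?thesis by blast
  qed
  \<comment> \<open>left multiplication on the first factor of \<open>M \<times> \<nat>\<close>, transported to \<open>\<omega>\<close>\<close>
  define act where "act m w = (case dec w of (m', n) \<Rightarrow> enc (m \<otimes>\<^bsub>M\<^esub> m', n))" for m w
  have act_enc: "act m (enc (m', n)) = enc (m \<otimes>\<^bsub>M\<^esub> m', n)" if "m' \<in> carrier M" for m m' n
    using dec_enc[OF that] by (simp add: act_def)
  have act_in: "act m w \<in> ?W" if "m \<in> carrier M" "w \<in> ?W" for m w
    using W_cases[OF that(2)] that(1) enc_in act_enc by auto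
  define \<sigma> where "\<sigma> = (\<lambda>m. on_Arr F (mapping ?W ?W (act m)))"
  show ?thesis
  proof (intro exI[of _ \<sigma>] conjI allI impI)
    show "monoid_action M C (on_Obj F ?W) \<sigma>"
      unfolding \<sigma>_def
    proof (rule monoid_action_free[OF W act_in])
      show "act \<one>\<^bsub>M\<^esub> w = w" if "w \<in> ?W" for w
        using W_cases[OF that] act_enc by auto
      show "act (m \<otimes>\<^bsub>M\<^esub> m') w = act m (act m' w)"
        if "m \<in> carrier M" "m' \<in> carrier M" "w \<in> ?W" for m m' w
        using W_cases[OF that(3)] that(1,2) act_enc by (auto simp: M.m_assoc)
    qed auto
  next
    fix A \<phi>
    assume A: "A \<in> Obj C" and cg: "countably_generated A" and \<phi>: "monoid_action M C A \<phi>"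
    obtain X where X: "countable X" "generated_by A X"
      using cg by (auto simp: countably_generated_def)
    then have X_sub: "X \<noteq> {}" "X \<subseteq> on_Obj V A"
      by (auto simp: generated_by_def)
    define s where "s = from_nat_into X"
    have s: "range s = X"
      unfolding s_def using X X_sub by (simp add: range_from_nat_into)
    then have s_in: "s n \<in> on_Obj V A" for n
      using X_sub by auto
    have \<phi>_arr: "\<phi> m \<in> arrows C A A" if "m \<in> carrier M" for m
      using \<phi> that by (auto simp: monoid_action_def hom_def End_def)
    \<comment> \<open>the equivariant extension of \<open>(1, n) \<mapsto> s n\<close>\<close>
    define f where "f w = (case dec w of (m, n) \<Rightarrow> fn (on_Arr V (\<phi> m)) (s n))" for w
    have f_enc: "f (enc (m, n)) = fn (on_Arr V (\<phi> m)) (s n)" if "m \<in> carrier M" for m n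
      using dec_enc[OF that] by (simp add: f_def)
    have "f w \<in> on_Obj V A" if "w \<in> ?W" for w
      using W_cases[OF that] f_enc fn_arrow_in[OF on_arrows[OF \<phi>_arr] s_in] by auto
    then have f_in: "f ` ?W \<subseteq> on_Obj V A"
      by blast
    have equivariant: "f (act m w) = fn (on_Arr V (\<phi> m)) (f w)"
      if "m \<in> carrier M" "w \<in> ?W" for m w
      using W_cases[OF that(2)] that(1) act_enc f_enc fn_action_mult[OF \<phi> _ _ s_in] by auto
    define f' where "f' = mapping ?W (on_Obj V A) f"
    have f': "f' \<in> arrows (Ens U) ?W (on_Obj V A)"
      unfolding f'_def using omega_in_U on_Obj_in_Obj[OF A] f_in
      by (intro mapping_in_arrows) (auto simp: Ens_def)
    have "s n = fn f' (enc (\<one>\<^bsub>M\<^esub>, n))" for n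
      using enc_in[OF M.one_closed] f_enc[OF M.one_closed] fn_action_one[OF A \<phi> s_in]
      by (simp add: f'_def mapping_def)
    then have "range s \<subseteq> fn f' ` ?W"
      using enc_in[OF M.one_closed] by blast
    then have "hat A f' \<in> N"
      using hat_nice[OF A X(2) f'] s by simp
    moreover have "hat A f' \<cdot>\<^bsub>C\<^esub> \<sigma> m = \<phi> m \<cdot>\<^bsub>C\<^esub> hat A f'" if m: "m \<in> carrier M" for m
    proof -
      have act_sub: "act m ` ?W \<subseteq> ?W"
        using act_in[OF m] by blast
      have "mapping ?W ?W (act m) \<in> arrows (Ens U) ?W ?W"
        using omega_in_U act_sub by (intro mapping_in_arrows) auto
      then have "hat A f' \<cdot>\<^bsub>C\<^esub> \<sigma> m = hat A (f' \<cdot>\<^bsub>Ens U\<^esub> mapping ?W ?W (act m))"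
        unfolding \<sigma>_def by (rule hat_natural[OF A f'])
      also have "f' \<cdot>\<^bsub>Ens U\<^esub> mapping ?W ?W (act m)
          = mapping ?W (on_Obj V A) (\<lambda>w. fn (on_Arr V (\<phi> m)) (f w))"
        unfolding f'_def Comp_mapping[OF act_sub] by (rule mapping_cong) (rule equivariant[OF m])
      also have "\<dots> = on_Arr V (\<phi> m) \<cdot>\<^bsub>Ens U\<^esub> f'"
        unfolding f'_def
        by (subst arrow_eq_mapping[OF on_arrows[OF \<phi>_arr[OF m]]])
          (rule Comp_mapping[OF f_in, symmetric])
      also have "hat A \<dots> = \<phi> m \<cdot>\<^bsub>C\<^esub> hat A f'"
        by (rule comp_hat[OF A A \<phi>_arr[OF m] f', symmetric])
      finally show ?thesis .
    qed
    ultimately show "\<exists>p \<in> arrows C (on_Obj F ?W) A. p \<in> N \<and>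
        (\<forall>m \<in> carrier M. p \<cdot>\<^bsub>C\<^esub> \<sigma> m = \<phi> m \<cdot>\<^bsub>C\<^esub> p)"
      using hat_props(1)[OF A f'] by blast
  qed
qed

end
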